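(* Let $\alpha,\beta$ be positive integers with $\gcd(\alpha,\beta)=1$ and let $r\in\mathbb N$. Then each of the following numbers (1) the number of isomorphism classes of $\langle\alpha,\beta\rangle$-semimodules minimally generated by $r+1$ elements, (2) the number of $\langle\alpha,\beta\rangle$-lean sets with $r$ gaps (i.e. of the form $\{0,x_1,\dots,x_r\}$ with exactly $r$ nonzero elements), (3) the number of lattice paths with $r$ ES-turns from $(0,\alpha)$ to $(\beta,0)$ staying below the diagonal, equals \[ L_{\alpha,\beta}(r):=\frac{1}{r+1}\binom{\alpha-1}{r}\binom{\beta-1}{r}. \]
   Context: $\mathbb N$ contains $0$. $\Gamma=\langle\alpha,\beta\rangle=\{a\alpha+b\beta\mid a,b\in\mathbb N\}$; its gaps are the elements of $\mathbb N\setminus\Gamma$. A $\Gamma$-semimodule is a non-empty subset $\Delta\subseteq\mathbb N$ with $\Delta+\Gamma\subseteq\Delta$; a system of generators is a subset $E\subseteq\Delta$ with $\bigcup_{x\in E}(x+\Gamma)=\Delta$, and each semimodule has a unique minimal system of generators. Semimodules $\Delta,\Delta'$ are isomorphic if $x\mapsto x+c$ is a bijection $\Delta\to\Delta'$ for some integer $c$. A set $\{x_0=0,x_1,\dots,x_n\}\subseteq\mathbb N$ is $\Gamma$-lean if $|x_i-x_j|\notin\Gamma$ for $0\le i<j\le n$ (so its nonzero elements are gaps of $\Gamma$). Lattice paths from $(0,\alpha)$ to $(\beta,0)$ consist of unit steps downwards $(0,-1)$ and to the right $(1,0)$. An ES-turn is a lattice point of the path at which a step to the right is immediately followed by a step downwards.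 The diagonal is the segment from $(0,\alpha)$ to $(\beta,0)$; a path stays below the diagonal if all its points $(x,y)$ satisfy $\alpha x+\beta y\le\alpha\beta$. *)

theory Defs
  imports Complex_Main
begin

definition semigroup2 :: "nat \<Rightarrow> nat \<Rightarrow> nat set" where
  "semigroup2 \<alpha> \<beta> = {a * \<alpha> + b * \<beta> | a b. True}"

definition semimodule :: "nat set \<Rightarrow> nat set \<Rightarrow> bool" where
  "semimodule \<Gamma> \<Delta> \<longleftrightarrow> \<Delta> \<noteq> {} \<and> (\<forall>x\<in>\<Delta>. \<forall>g\<in>\<Gamma>. x + g \<in> \<Delta>)"

definition generates :: "nat set \<Rightarrow> nat set \<Rightarrow> nat set \<Rightarrow> bool" where
  "generates \<Gamma> E \<Delta> \<longleftrightarrow> E \<subseteq> \<Delta> \<and> (\<Union>x\<in>E. (+) x ` \<Gamma>) = \<Delta>"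

definition minimally_generates :: "nat set \<Rightarrow> nat set \<Rightarrow> nat set \<Rightarrow> bool" where
  "minimally_generates \<Gamma> E \<Delta> \<longleftrightarrow> generates \<Gamma> E \<Delta> \<and> (\<forall>F. F \<subset> E \<longrightarrow> \<not> generates \<Gamma> F \<Delta>)"

(* The shift may be negative, so it is taken in the integers. *)
definition semimodule_iso :: "nat set \<Rightarrow> (nat set \<times> nat set) set" where
  "semimodule_iso \<Gamma> = {(\<Delta>, \<Delta>'). semimodule \<Gamma> \<Delta> \<and> semimodule \<Gamma> \<Delta>' \<and>
     (\<exists>c::int. bij_betw (\<lambda>x. int x + c) \<Delta> (int ` \<Delta>'))}"

definition semimodule_classes :: "nat set \<Rightarrow> nat \<Rightarrow> nat set set set" where
  "semimodule_classes \<Gamma> k =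
     {\<Delta>. semimodule \<Gamma> \<Delta> \<and> (\<exists>E. finite E \<and> card E = k \<and> minimally_generates \<Gamma> E \<Delta>)}
       // semimodule_iso \<Gamma>"

definition lean :: "nat set \<Rightarrow> nat set \<Rightarrow> bool" where
  "lean \<Gamma> X \<longleftrightarrow> finite X \<and> 0 \<in> X \<and>
     (\<forall>x\<in>X. \<forall>y\<in>X. x \<noteq> y \<longrightarrow> nat \<bar>int x - int y\<bar> \<notin> \<Gamma>)"

(* If 0 is in \<Gamma>, all nonzero elements of a lean set are gaps of \<Gamma>. *)
definition lean_sets :: "nat set \<Rightarrow> nat \<Rightarrow> nat set set" where
  "lean_sets \<Gamma> r = {X. lean \<Gamma> X \<and> card (X - {0}) = r}"

type_synonym point = "int \<times> int"

definition east_step :: "point \<Rightarrow> point \<Rightarrow> bool" where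
  "east_step p q \<longleftrightarrow> q = (fst p + 1, snd p)"

definition south_step :: "point \<Rightarrow> point \<Rightarrow> bool" where
  "south_step p q \<longleftrightarrow> q = (fst p, snd p - 1)"

(* A path is the list of the lattice points it visits, in order. *)
definition lattice_path :: "point \<Rightarrow> point \<Rightarrow> point list \<Rightarrow> bool" where
  "lattice_path p q ps \<longleftrightarrow> ps \<noteq> [] \<and> hd ps = p \<and> last ps = q \<and>
     (\<forall>i. Suc i < length ps \<longrightarrow>
        east_step (ps ! i) (ps ! Suc i) \<or> south_step (ps ! i) (ps ! Suc i))"

definition ES_turns :: "point list \<Rightarrow> point set" where
  "ES_turns ps = {ps ! Suc i | i. Suc (Suc i) < length ps \<and>
     east_step (ps ! i) (ps ! Suc i) \<and> south_step (ps ! Suc i) (ps ! Suc (Suc i))}"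

(* It is enough to constrain the lattice points, since the half-plane is convex. *)
definition below_diagonal :: "nat \<Rightarrow> nat \<Rightarrow> point list \<Rightarrow> bool" where
  "below_diagonal \<alpha> \<beta> ps \<longleftrightarrow>
     (\<forall>(x, y)\<in>set ps. int \<alpha> * x + int \<beta> * y \<le> int \<alpha> * int \<beta>)"

definition paths_below_diagonal :: "nat \<Rightarrow> nat \<Rightarrow> nat \<Rightarrow> point list set" where
  "paths_below_diagonal \<alpha> \<beta> r = {ps. lattice_path (0, int \<alpha>) (int \<beta>, 0) ps \<and>
     below_diagonal \<alpha> \<beta> ps \<and> card (ES_turns ps) = r}"

definition L :: "nat \<Rightarrow> nat \<Rightarrow> nat \<Rightarrow> real" where
  "L \<alpha> \<beta> r = 1 / (real r + 1) * real ((\<alpha> - 1) choose r) * real ((\<beta> - 1) choose r)"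

end

theory Submission
  imports Defs
begin

text \<open>A path from \<open>(0, \<alpha>)\<close> to \<open>(\<beta>, 0)\<close> below the diagonal starts with a south step and ends with an east
  step, so with \<open>r\<close> ES-turns it is a sequence of \<open>r + 1\<close> blocks \<open>(s, e)\<close> of positive run lengths, that
  is, a pair of compositions of \<open>\<alpha>\<close> and of \<open>\<beta>\<close> into \<open>r + 1\<close> parts. Being below the diagonal means that
  all prefix sums of \<open>\<beta> s - \<alpha> e\<close> are nonnegative. By coprimality the prefix sums over one period are
  distinct, hence exactly one of the \<open>r + 1\<close> rotations of a pair of compositions has this property
  (the one starting at the minimal prefix sum), which explains the factor \<open>1 / (r + 1)\<close>.

  The prefix sums \<open>\<beta> S - \<alpha> E\<close> of such a sequence form a lean set: among points of the box
  \<open>S < \<alpha>\<close>, \<open>E < \<beta>\<close> the difference of two values lies outside \<open>\<langle>\<alpha>, \<beta>\<rangle>\<close> iff one point is strictly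
  smaller in both coordinates, so lean sets are exactly the chains of nonnegative points through
  the origin. Finally, a set is lean iff it contains \<open>0\<close> and minimally generates a semimodule, and
  every semimodule has a unique translate with minimum \<open>0\<close>.\<close>

section \<open>The cycle lemma\<close>

definition compositions :: "nat \<Rightarrow> nat \<Rightarrow> nat list set" where
  "compositions n k = {l. length l = k \<and> 0 \<notin> set l \<and> sum_list l = n}"

lemma sum_list_ge_length: "0 \<notin> set l \<Longrightarrow> length l \<le> sum_list (l :: nat list)"
  by (induction l) auto

text \<open>Subtracting one from every part leaves arbitrary lists of length \<open>r + 1\<close>,
  which stars and bars counts. The assumption excludes \<open>n = 0\<close>, \<open>r = 0\<close>,
  where truncated subtraction would make the binomial 1.\<close>

lemma finite_card_compositions:
  assumes "0 < n"
  shows "finite (compositions n (Suc r))" "card (compositions n (Suc r)) = (n - 1) choose r"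
proof -
  let ?B = "{l::nat list. length l = Suc r \<and> sum_list l = n - Suc r}"
  have "finite (compositions n (Suc r)) \<and> card (compositions n (Suc r)) = (n - 1) choose r"
  proof (cases "Suc r \<le> n")
    case True
    have sum_Suc: "sum_list (map Suc l) = length l + sum_list l" for l
      by (induction l) auto
    have "compositions n (Suc r) = map Suc ` ?B"
    proof (intro equalityI subsetI)
      fix l assume l: "l \<in> compositions n (Suc r)"
      then have "map Suc (map (\<lambda>x. x - 1) l) = l"
        unfolding compositions_def by (auto intro!: map_idI Suc_pred gr0I)
      moreover from this have "sum_list (map (\<lambda>x. x - 1) l) = n - Suc r"
        using sum_Suc[of "map (\<lambda>x. x - 1) l"] l by (auto simp: compositions_def)
      ultimately show "l \<in> map Suc ` ?B"
        using l by (intro image_eqI[of _ _ "map (\<lambda>x. x - 1) l"]) (auto simp: compositions_def)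
    qed (use True in \<open>auto simp: compositions_def sum_Suc\<close>)
    moreover have "card ?B = (n - 1) choose r"
      using True binomial_symmetric[of r "n - 1"] by (simp add: card_length_sum_list)
    moreover have "finite ?B"
      by (rule finite_subset[OF _ finite_lists_length_eq[of "{..n}" "Suc r"]])
         (auto dest: member_le_sum_list)
    ultimately show ?thesis
      by (simp add: card_image inj_on_def)
  next
    case False
    then have "compositions n (Suc r) = {}"
      by (auto simp: compositions_def dest: sum_list_ge_length)
    with False assms show ?thesis by (simp add: binomial_eq_0)
  qed
  then show "finite (compositions n (Suc r))" "card (compositions n (Suc r)) = (n - 1) choose r"
    by auto
qed

text \<open>A pair \<open>(s, e)\<close> in such a list encodes \<open>s\<close> south steps followed by \<open>e\<close> east steps.\<close>

definition bicompositions :: "nat \<Rightarrow> nat \<Rightarrow> nat \<Rightarrow> (nat \<times> nat) list set" where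
  "bicompositions a b k = {w. map fst w \<in> compositions a k \<and> map snd w \<in> compositions b k}"

lemma finite_card_bicompositions:
  assumes "0 < a" "0 < b"
  shows "finite (bicompositions a b (Suc r))"
    "card (bicompositions a b (Suc r)) = ((a - 1) choose r) * ((b - 1) choose r)"
proof -
  have "bij_betw (\<lambda>w. (map fst w, map snd w)) (bicompositions a b (Suc r))
          (compositions a (Suc r) \<times> compositions b (Suc r))"
    by (rule bij_betw_byWitness[where f' = "\<lambda>(s, e). zip s e"])
       (auto simp: bicompositions_def compositions_def zip_map_fst_snd
             dest: set_zip_leftD set_zip_rightD)
  then show "finite (bicompositions a b (Suc r))"
    "card (bicompositions a b (Suc r)) = ((a - 1) choose r) * ((b - 1) choose r)"
    using finite_card_compositions assms
    by (auto simp: bij_betw_finite bij_betw_same_card card_cartesian_product)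
qed

text \<open>For the point reached after \<open>fst p\<close> south and \<open>snd p\<close> east steps from \<open>(0, a)\<close> this is
  \<open>a b - a x - b y\<close>, the amount by which the point lies below the diagonal.\<close>

definition height :: "nat \<Rightarrow> nat \<Rightarrow> nat \<times> nat \<Rightarrow> int" where
  "height a b p = int b * int (fst p) - int a * int (snd p)"

definition block_sum :: "(nat \<times> nat) list \<Rightarrow> nat \<times> nat" where
  "block_sum w = (sum_list (map fst w), sum_list (map snd w))"

text \<open>Testing the block ends suffices for a path: within a block the height first rises along
  the south run and then falls along the east run.\<close>

definition dominating :: "nat \<Rightarrow> nat \<Rightarrow> nat \<Rightarrow> (nat \<times> nat) list set" where
  "dominating a b k =
     {w \<in> bicompositions a b k. \<forall>i\<le>k. 0 \<le> height a b (block_sum (take i w))}"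

section \<open>Prefix heights under rotation\<close>

lemma height_block_sum_append:
  "height a b (block_sum (u @ v)) = height a b (block_sum u) + height a b (block_sum v)"
  by (simp add: height_def block_sum_def algebra_simps)

lemma bicompositions_length: "w \<in> bicompositions a b k \<Longrightarrow> length w = k"
  by (auto simp: bicompositions_def compositions_def)

lemma block_sum_bicompositions: "w \<in> bicompositions a b k \<Longrightarrow> block_sum w = (a, b)"
  by (auto simp: bicompositions_def compositions_def block_sum_def)

lemma rotate_bicompositions:
  "rotate j w \<in> bicompositions a b k \<longleftrightarrow> w \<in> bicompositions a b k"
proof -
  have "sum_list (rotate j l) = sum_list l" for l :: "nat list"
    by (metis add.commute append_take_drop_id rotate_drop_take sum_list_append)
  then show ?thesis
    by (simp add: bicompositions_def compositions_def rotate_map[symmetric])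
qed

text \<open>The prefix heights of a rotation are those of the original list shifted by a constant, since
  the total height is zero.\<close>

lemma rotate_dominating_iff:
  assumes w: "w \<in> bicompositions a b k" and j: "j < k"
  shows "rotate j w \<in> dominating a b k \<longleftrightarrow>
    (\<forall>i<k. height a b (block_sum (take j w)) \<le> height a b (block_sum (take i w)))"
    (is "_ \<longleftrightarrow> (\<forall>i<k. ?D j \<le> ?D i)")
proof -
  have len: "length w = k" using w by (rule bicompositions_length)
  have zero: "?D k = 0" "?D 0 = 0"
    using block_sum_bicompositions[OF w] len by (simp_all add: height_def block_sum_def)
  have rot: "rotate j w = drop j w @ take j w"
    using len j by (simp add: rotate_drop_take)
  \<comment> \<open>\<open>early\<close> treats prefixes of the rotation that stay within
    \<open>drop j w\<close>; \<open>late\<close> treats those that wrap around, where the total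
    height zero yields the same shift by \<open>?D j\<close>.\<close>
  have early: "height a b (block_sum (take i (rotate j w))) = ?D (j + i) - ?D j" if "i \<le> k - j" for i
    using that len j height_block_sum_append[of a b "take j w" "take i (drop j w)"]
    by (simp add: rot take_add)
  have late: "height a b (block_sum (take i (rotate j w))) = ?D (i + j - k) - ?D j"
    if "k - j \<le> i" "i \<le> k" for i
  proof -
    have "take i (rotate j w) = drop j w @ take (i + j - k) w"
      using that len j by (simp add: rot)
    moreover have "?D j + height a b (block_sum (drop j w)) = 0"
      using height_block_sum_append[of a b "take j w" "drop j w"] zero len by simp
    ultimately show ?thesis by (simp add: height_block_sum_append)
  qed
  have "rotate j w \<in> dominating a b k \<longleftrightarrow>
      (\<forall>i\<le>k. 0 \<le> height a b (block_sum (take i (rotate j w))))"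
    using w by (simp add: dominating_def rotate_bicompositions)
  also have "\<dots> \<longleftrightarrow> (\<forall>i<k. ?D j \<le> ?D i)"
  proof safe
    fix i assume *: "\<forall>i\<le>k. 0 \<le> height a b (block_sum (take i (rotate j w)))" "i < k"
    show "?D j \<le> ?D i"
    proof (cases "j \<le> i")
      case True
      with *(2) have "0 \<le> ?D i - ?D j"
        using early[of "i - j"] spec[OF *(1), of "i - j"] by (simp add: diff_le_mono)
      then show ?thesis by simp
    next
      case False
      with *(2) j have "0 \<le> ?D i - ?D j"
        using late[of "i + k - j"] spec[OF *(1), of "i + k - j"] by simp
      then show ?thesis by simp
    qed
  next
    fix i assume *: "\<forall>i<k. ?D j \<le> ?D i" "i \<le> k"
    \<comment> \<open>The hypothesis covers only indices below \<open>k\<close>; at \<open>k\<close>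
      the prefix height equals the one at 0.\<close>
    have D: "?D j \<le> ?D i'" if "i' \<le> k" for i'
      using *(1) that zero j by (cases "i' = k") (auto dest: spec[of _ 0])
    show "0 \<le> height a b (block_sum (take i (rotate j w)))"
    proof (cases "i \<le> k - j")
      case True
      then show ?thesis using early D[of "j + i"] j by simp
    next
      case False
      then show ?thesis using late D[of "i + j - k"] *(2) j by simp
    qed
  qed
  finally show ?thesis .
qed

text \<open>All parts are positive, so both partial sums grow with every block. Hence the prefix
  points are distinct and form a chain.\<close>

lemma block_sum_take_strict_mono:
  assumes w: "w \<in> bicompositions a b k" and "i < j" "j \<le> k"
  shows "fst (block_sum (take i w)) < fst (block_sum (take j w))"
    "snd (block_sum (take i w)) < snd (block_sum (take j w))"
proof -
  have pos: "0 < fst (w ! i)" "0 < snd (w ! i)"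
  proof -
    have "w ! i \<in> set w" using assms(2,3) bicompositions_length[OF w] by simp
    then have "fst (w ! i) \<in> set (map fst w)" "snd (w ! i) \<in> set (map snd w)"
      by auto
    then show "0 < fst (w ! i)" "0 < snd (w ! i)"
      using w by (auto simp only: bicompositions_def compositions_def mem_Collect_eq intro!: gr0I)
  qed
  have "take j w = take i w @ w ! i # drop (Suc i) (take j w)"
    using id_take_nth_drop[of i "take j w"] assms(2,3) bicompositions_length[OF w]
    by (simp add: min_absorb1)
  then have "block_sum (take j w) = block_sum (take i w @ w ! i # drop (Suc i) (take j w))"
    by simp
  then show "fst (block_sum (take i w)) < fst (block_sum (take j w))"
    "snd (block_sum (take i w)) < snd (block_sum (take j w))"
    using pos by (simp_all add: block_sum_def)
qed

text \<open>Equal heights give \<open>b * (fst p - fst q) = a * (snd p - snd q)\<close> over the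
  integers, so by coprimality \<open>a\<close> divides a difference of absolute value below
  \<open>a\<close>.\<close>

lemma height_inj_on_box:
  assumes cop: "coprime a b" and "fst p < a" "fst q < a"
    and "height a b p = height a b q" and "0 < a"
  shows "p = q"
proof -
  have eq: "int b * (int (fst p) - int (fst q)) = int a * (int (snd p) - int (snd q))"
    using assms(4) by (simp add: height_def algebra_simps)
  then have "int a dvd int (fst p) - int (fst q)"
    using cop by (metis coprime_dvd_mult_right_iff coprime_int_iff dvd_triv_left)
  moreover have "\<bar>int (fst p) - int (fst q)\<bar> < int a" using assms(2,3) by auto
  ultimately have "fst p = fst q"
    using dvd_imp_le_int[of "int (fst p) - int (fst q)" "int a"] by fastforce
  with eq \<open>0 < a\<close> show ?thesis by (simp add: prod_eq_iff)
qed

text \<open>A rotation is dominating iff it starts at a minimum of the prefix heights. The first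
  \<open>k\<close> prefix points have first coordinate below \<open>a\<close>, so their heights are
  distinct and the minimum is attained only once.\<close>

lemma ex1_rotate_dominating:
  assumes cop: "coprime a b" and w: "w \<in> bicompositions a b k" and "0 < k" "0 < a"
  shows "\<exists>!j. j < k \<and> rotate j w \<in> dominating a b k"
proof -
  let ?D = "\<lambda>i. height a b (block_sum (take i w))"
  have fst_less: "fst (block_sum (take i w)) < a" if "i < k" for i
    using block_sum_take_strict_mono(1)[OF w that] block_sum_bicompositions[OF w] bicompositions_length[OF w]
    by simp
  have inj: "i = j" if "i < k" "j < k" "?D i = ?D j" for i j
  proof -
    have "block_sum (take i w) = block_sum (take j w)"
      using height_inj_on_box[OF cop fst_less fst_less] that \<open>0 < a\<close> by blast
    then show ?thesis
      using block_sum_take_strict_mono(1)[OF w, of i j] block_sum_take_strict_mono(1)[OF w, of j i] that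
      by (cases i j rule: linorder_cases) auto
  qed
  obtain m where m: "m < k" "\<And>i. i < k \<Longrightarrow> ?D m \<le> ?D i"
    using \<open>0 < k\<close> ex_is_arg_min_if_finite[of "{..<k}" ?D] by (auto simp: is_arg_min_linorder)
  show ?thesis
  proof (rule ex1I[of _ m])
    show "m < k \<and> rotate m w \<in> dominating a b k"
      using m rotate_dominating_iff[OF w] by simp
    fix j assume "j < k \<and> rotate j w \<in> dominating a b k"
    then have "j < k" "?D j \<le> ?D m"
      using m(1) rotate_dominating_iff[OF w, of j] by auto
    then show "j = m" using inj m by (meson order_antisym)
  qed
qed

text \<open>Double counting of the pairs \<open>(j, w)\<close> with \<open>rotate j w\<close>
  dominating: every \<open>w\<close> admits exactly one \<open>j\<close>, and for every
  \<open>j\<close> rotation is a bijection onto the dominating lists.\<close>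

lemma finite_card_dominating:
  assumes "coprime a b" "0 < a" "0 < b"
  shows "finite (dominating a b (Suc r))"
    "Suc r * card (dominating a b (Suc r)) = ((a - 1) choose r) * ((b - 1) choose r)"
proof -
  let ?k = "Suc r" and ?W = "bicompositions a b (Suc r)"
  have fin: "finite ?W" using assms by (simp add: finite_card_bicompositions)
  then show "finite (dominating a b ?k)" by (simp add: dominating_def)
  have col: "card {w \<in> ?W. rotate j w \<in> dominating a b ?k} = card (dominating a b ?k)"
    if "j < ?k" for j
  proof (rule bij_betw_same_card)
    show "bij_betw (rotate j) {w \<in> ?W. rotate j w \<in> dominating a b ?k} (dominating a b ?k)"
    proof (rule bij_betw_imageI)
      show "inj_on (rotate j) {w \<in> ?W. rotate j w \<in> dominating a b ?k}"
        by (rule inj_on_subset[OF inj_fn[OF inj_rotate1, of j, folded rotate_def]]) simp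
      have "g \<in> rotate j ` {w \<in> ?W. rotate j w \<in> dominating a b ?k}"
        if g: "g \<in> dominating a b ?k" for g
      proof -
        have "g \<in> ?W" using g by (simp add: dominating_def)
        moreover from this have "rotate j (rotate (?k - j) g) = g"
          using \<open>j < ?k\<close> bicompositions_length[of g a b ?k] rotate_id[of ?k g]
          by (simp add: rotate_rotate)
        ultimately show ?thesis
          using g by (intro image_eqI[of _ _ "rotate (?k - j) g"]) (auto simp: rotate_bicompositions)
      qed
      then show "rotate j ` {w \<in> ?W. rotate j w \<in> dominating a b ?k} = dominating a b ?k"
        by auto
    qed
  qed
  have row: "card {j \<in> {..<?k}. rotate j w \<in> dominating a b ?k} = 1" if "w \<in> ?W" for w
    using ex1_rotate_dominating[OF assms(1) that _ assms(2)] by (auto simp: card_1_singleton_iff)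
  have "(\<Sum>j<?k. card {w \<in> ?W. rotate j w \<in> dominating a b ?k}) = 1 * card ?W"
    using fin row by (intro sum_multicount) auto
  then show "?k * card (dominating a b ?k) = ((a - 1) choose r) * ((b - 1) choose r)"
    using col assms by (simp add: finite_card_bicompositions)
qed

section \<open>Lattice paths\<close>

text \<open>\<open>True\<close> encodes an east step and \<open>False\<close> a south step.\<close>

fun trace :: "point \<Rightarrow> bool list \<Rightarrow> point list" where
  "trace p [] = [p]"
| "trace p (d # u) = p # trace (if d then (fst p + 1, snd p) else (fst p, snd p - 1)) u"

lemma trace_neq_Nil [simp]: "trace p u \<noteq> []"
  by (cases u) auto

lemma hd_trace [simp]: "hd (trace p u) = p"
  by (cases u) auto

lemma start_in_trace [simp]: "p \<in> set (trace p u)"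
  by (cases u) auto

lemma trace_inj: "trace p u = trace p v \<Longrightarrow> u = v"
proof (induction u arbitrary: p v)
  case Nil
  then show ?case by (cases v) (auto simp: trace_neq_Nil[symmetric])
next
  case (Cons d u)
  then obtain d' v' where v: "v = d' # v'" by (cases v) auto
  have eq: "trace (if d then (fst p + 1, snd p) else (fst p, snd p - 1)) u =
      trace (if d' then (fst p + 1, snd p) else (fst p, snd p - 1)) v'" (is "?l = ?r")
    using Cons.prems v by simp
  then have "hd ?l = hd ?r" by simp
  then have "d = d'" by (auto split: if_splits)
  with eq Cons.IH v show ?case by simp
qed

text \<open>Splitting off index 0 turns the index-based definition into a recursion. It inspects two
  leading points because a step involves both.\<close>

lemma lattice_path_simps:
  "\<not> lattice_path p q []"
  "lattice_path p q [x] \<longleftrightarrow> x = p \<and> p = q"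
  "lattice_path p q (x # y # ps) \<longleftrightarrow>
     x = p \<and> (east_step p y \<or> south_step p y) \<and> lattice_path y q (y # ps)"
proof -
  have all: "(\<forall>i. Q i) \<longleftrightarrow> Q 0 \<and> (\<forall>i. Q (Suc i))" for Q :: "nat \<Rightarrow> bool"
    by (metis not0_implies_Suc)
  show "\<not> lattice_path p q []" "lattice_path p q [x] \<longleftrightarrow> x = p \<and> p = q"
    by (auto simp: lattice_path_def)
  show "lattice_path p q (x # y # ps) \<longleftrightarrow>
     x = p \<and> (east_step p y \<or> south_step p y) \<and> lattice_path y q (y # ps)"
    unfolding lattice_path_def by (subst all) auto
qed

lemma lattice_path_iff_trace:
  "lattice_path p q ps \<longleftrightarrow> (\<exists>u. ps = trace p u \<and>
     q = (fst p + int (count_list u True), snd p - int (count_list u False)))"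
proof
  assume "lattice_path p q ps"
  then show "\<exists>u. ps = trace p u \<and>
     q = (fst p + int (count_list u True), snd p - int (count_list u False))"
  proof (induction ps arbitrary: p)
    case Nil
    then show ?case by (simp add: lattice_path_simps)
  next
    case (Cons x xs)
    show ?case
    proof (cases xs)
      case Nil
      with Cons.prems show ?thesis by (intro exI[of _ "[]"]) (auto simp: lattice_path_simps)
    next
      case (Cons y ys)
      with \<open>lattice_path p q (x # xs)\<close>
      have *: "x = p" "east_step p y \<or> south_step p y" "lattice_path y q xs"
        by (auto simp: lattice_path_simps)
      from Cons.IH[OF *(3)] obtain u where u: "xs = trace y u"
        "q = (fst y + int (count_list u True), snd y - int (count_list u False))" by auto
      from *(2) show ?thesis
      proof
        assume "east_step p y"
        then show ?thesis using u *(1)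
          by (intro exI[of _ "True # u"]) (auto simp: east_step_def)
      next
        assume "south_step p y"
        then show ?thesis using u *(1)
          by (intro exI[of _ "False # u"]) (auto simp: south_step_def)
      qed
    qed
  qed
next
  have "lattice_path p (fst p + int (count_list u True), snd p - int (count_list u False))
     (trace p u)" for u
  proof (induction u arbitrary: p)
    case Nil
    then show ?case by (simp add: lattice_path_simps)
  next
    case (Cons d u)
    let ?p = "if d then (fst p + 1, snd p) else (fst p, snd p - 1)"
    obtain ys where ys: "trace ?p u = ?p # ys"
      by (metis hd_trace list.collapse trace_neq_Nil)
    have "lattice_path ?p (fst ?p + int (count_list u True), snd ?p - int (count_list u False))
        (?p # ys)"
      using Cons.IH[of ?p] ys by simp
    then show ?case using ys
      by (auto simp: lattice_path_simps east_step_def south_step_def algebra_simps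
          split: if_splits)
  qed
  then show "\<exists>u. ps = trace p u \<and>
     q = (fst p + int (count_list u True), snd p - int (count_list u False)) \<Longrightarrow>
     lattice_path p q ps" by blast
qed

fun turns :: "bool list \<Rightarrow> nat" where
  "turns (x # y # u) = (if x \<and> \<not> y then 1 else 0) + turns (y # u)"
| "turns u = 0"

text \<open>Each step, east or south, raises the difference of the coordinates by one; therefore no
  path visits a point twice.\<close>

lemma set_trace_ge: "q \<in> set (trace p u) \<Longrightarrow> fst p - snd p \<le> fst q - snd q"
  by (induction u arbitrary: p) (fastforce split: if_splits)+

lemma ES_turns_Cons:
  "ES_turns (p # q # s # ps) =
    (if east_step p q \<and> south_step q s then {q} else {}) \<union> ES_turns (q # s # ps)"
proof -
  have ex: "(\<exists>i. Q i) \<longleftrightarrow> Q 0 \<or> (\<exists>i. Q (Suc i))" for Q :: "nat \<Rightarrow> bool"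
    by (metis not0_implies_Suc)
  show ?thesis
    unfolding ES_turns_def
    by (rule set_eqI, simp only: mem_Collect_eq Un_iff, subst ex) auto
qed

lemma ES_turns_subset: "ES_turns ps \<subseteq> set (tl ps)"
proof
  fix q assume "q \<in> ES_turns ps"
  then obtain i where "q = tl ps ! i" "i < length (tl ps)"
    by (auto simp: ES_turns_def nth_tl)
  then show "q \<in> set (tl ps)" by simp
qed

lemma ES_turns_short: "length ps \<le> 2 \<Longrightarrow> ES_turns ps = {}"
  by (auto simp: ES_turns_def)

lemma finite_ES_turns: "finite (ES_turns ps)"
  using ES_turns_subset finite_subset by blast

text \<open>\<open>ES_turns\<close> is a set of points whereas \<open>turns\<close> counts positions
  in the word. They agree because points do not recur.\<close>

lemma card_ES_turns_trace: "card (ES_turns (trace p u)) = turns u"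
proof (induction u arbitrary: p rule: turns.induct)
  case (1 x y u)
  let ?q = "if x then (fst p + 1, snd p) else (fst p, snd p - 1)"
  let ?s = "if y then (fst ?q + 1, snd ?q) else (fst ?q, snd ?q - 1)"
  obtain ps where ps: "trace ?s u = ?s # ps"
    by (metis hd_trace list.collapse trace_neq_Nil)
  \<comment> \<open>All later points have a larger difference of coordinates than
    \<open>?q\<close>.\<close>
  have "?q \<notin> set (trace ?s u)"
    using set_trace_ge[of ?q ?s u] by (auto split: if_splits)
  then have notin: "?q \<notin> ES_turns (trace ?q (y # u))"
    using ES_turns_subset[of "trace ?q (y # u)"] by auto
  have eq: "ES_turns (trace p (x # y # u)) =
      (if x \<and> \<not> y then {?q} else {}) \<union> ES_turns (trace ?q (y # u))"
    using ps by (simp add: ES_turns_Cons) (simp add: east_step_def south_step_def)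
  have card: "card ((if P then {q} else {}) \<union> T) = (if P then 1 else 0) + card T"
    if "q \<notin> T" "finite T" for P and q :: point and T
    using that by simp
  show ?case
    unfolding eq card[OF notin finite_ES_turns] 1 by simp
qed (auto simp: ES_turns_short)

section \<open>Words as sequences of south-east blocks\<close>

definition blocks :: "(nat \<times> nat) list \<Rightarrow> bool list" where
  "blocks w = concat (map (\<lambda>(s, e). replicate s False @ replicate e True) w)"

text \<open>Positivity makes the runs maximal, so that a word determines its blocks.\<close>

definition positive :: "(nat \<times> nat) list \<Rightarrow> bool" where
  "positive w \<longleftrightarrow> (\<forall>d\<in>set w. 0 < fst d \<and> 0 < snd d)"

lemma blocks_simps [simp]:
  "blocks [] = []"
  "blocks (d # w) = replicate (fst d) False @ replicate (snd d) True @ blocks w"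
  by (simp_all add: blocks_def case_prod_beta)

lemma positive_simps [simp]:
  "positive []"
  "positive (d # w) \<longleftrightarrow> 0 < fst d \<and> 0 < snd d \<and> positive w"
  by (auto simp: positive_def)

lemma bicompositions_iff:
  "w \<in> bicompositions a b k \<longleftrightarrow> length w = k \<and> positive w \<and> block_sum w = (a, b)"
  by (induction w arbitrary: a b k)
     (auto simp: bicompositions_def compositions_def block_sum_def positive_def)

lemma count_list_blocks:
  "count_list (blocks w) True = snd (block_sum w)" "count_list (blocks w) False = fst (block_sum w)"
proof -
  have "count_list (replicate n x) y = (if x = y then n else 0)" for n and x y :: bool
    by (induction n) auto
  then show "count_list (blocks w) True = snd (block_sum w)"
    "count_list (blocks w) False = fst (block_sum w)"
    by (induction w) (auto simp: block_sum_def)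
qed

lemma turns_False: "turns (False # u) = turns u"
  by (cases u) auto

text \<open>East is followed by south exactly at the boundaries between consecutive blocks.\<close>

lemma turns_blocks: "positive w \<Longrightarrow> turns (blocks w) = length w - 1"
proof (induction w)
  case (Cons d w)
  have False_run: "turns (replicate s False @ u) = turns u" for s u
    by (induction s) (auto simp: turns_False)
  have True_run: "turns (replicate (Suc e) True @ False # u) = Suc (turns u)" for e u
    by (induction e) (auto simp: turns_False)
  have True_end: "turns (replicate e True) = 0" for e
    by (induction e rule: induct_nat_012) auto
  show ?case
  proof (cases w)
    case Nil
    then show ?thesis by (simp add: False_run True_end)
  next
    case (Cons d' w')
    with Cons.prems obtain s' e where "fst d' = Suc s'" "snd d = Suc e"
      by (auto simp: gr0_conv_Suc)
    then show ?thesis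
      using Cons.IH Cons.prems Cons True_run[of e]
      by (simp add: False_run turns_False del: replicate_Suc)
         (simp add: False_run turns_False)
  qed
qed simp

text \<open>The first block is recovered by reading off the initial run of \<open>False\<close> and
  then the run of \<open>True\<close>.\<close>

lemma blocks_inj: "positive w \<Longrightarrow> positive v \<Longrightarrow> blocks w = blocks v \<Longrightarrow> w = v"
proof (induction w arbitrary: v)
  case Nil
  then show ?case by (cases v) auto
next
  case (Cons d w)
  then obtain c v' where v: "v = c # v'" by (cases v) auto
  have S: "takeWhile Not (replicate s False @ replicate e True @ u) = replicate s False"
    if "0 < e" for s e u
    using that by (induction s) (auto simp: gr0_conv_Suc)
  have "replicate (fst d) False = replicate (fst c) False"
    using S[of "snd d" "fst d" "blocks w"] S[of "snd c" "fst c" "blocks v'"] Cons.prems v by simp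
  then have fst_eq: "fst d = fst c" by (metis length_replicate)
  then have rest: "replicate (snd d) True @ blocks w = replicate (snd c) True @ blocks v'"
    using Cons.prems v by simp
  \<comment> \<open>By positivity \<open>blocks x\<close> is empty or starts with
    \<open>False\<close>, so the run of \<open>True\<close> stops there.\<close>
  have E: "takeWhile id (replicate e True @ blocks x) = replicate e True" if "positive x" for e x
    using that by (induction e) (cases x, auto simp: gr0_conv_Suc)+
  have "replicate (snd d) True = replicate (snd c) True"
    using E[of w "snd d"] E[of v' "snd c"] Cons.prems v rest by simp
  then have "snd d = snd c" by (metis length_replicate)
  with fst_eq rest Cons v show ?case by (simp add: prod_eq_iff)
qed

text \<open>Generalises \<open>ex_blocks\<close> for the induction: a suffix of the word may begin
  inside an east run, whence the leading \<open>e\<close> east steps.\<close>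

lemma ex_blocks_aux:
  "u \<noteq> [] \<Longrightarrow> last u \<Longrightarrow> \<exists>e w. u = replicate e True @ blocks w \<and> positive w"
proof (induction u)
  case (Cons x u)
  show ?case
  proof (cases "u = []")
    case True
    with Cons.prems show ?thesis
      by (intro exI[of _ 1] exI[of _ "[]"]) auto
  next
    case False
    with Cons obtain e w where IH: "u = replicate e True @ blocks w" "positive w"
      by auto
    show ?thesis
    proof (cases x)
      case True
      with IH show ?thesis by (intro exI[of _ "Suc e"] exI[of _ w]) auto
    next
      case x: False
      show ?thesis
      \<comment> \<open>A new south step lengthens the first block if no east run is open; otherwise
        it closes the open run into the block \<open>(1, e)\<close>.\<close>
      proof (cases "e = 0")
        case True
        with IH False obtain d w' where "w = d # w'" by (cases w) auto
        with IH x True show ?thesis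
          by (intro exI[of _ 0] exI[of _ "(Suc (fst d), snd d) # w'"]) auto
      next
        case False
        with IH x show ?thesis
          by (intro exI[of _ 0] exI[of _ "(1, e) # w"]) auto
      qed
    qed
  qed
qed simp

lemma ex_blocks:
  assumes "u \<noteq> []" "last u" "\<not> hd u"
  shows "\<exists>w. u = blocks w \<and> positive w"
proof -
  obtain e w where "u = replicate e True @ blocks w" "positive w"
    using ex_blocks_aux assms by blast
  with assms show ?thesis by (cases e) auto
qed

section \<open>The diagonal constraint in terms of block heights\<close>

definition level :: "nat \<Rightarrow> nat \<Rightarrow> point \<Rightarrow> int" where
  "level a b p = int a * fst p + int b * snd p"

lemma below_diagonal_iff: "below_diagonal a b ps \<longleftrightarrow> (\<forall>q\<in>set ps. level a b q \<le> int a * int b)"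
  by (auto simp: below_diagonal_def level_def)

text \<open>South steps lower the level, so the start of the run is its highest point. In
  \<open>level_trace_True\<close> the level rises, so the end of the run implies the rest.\<close>

lemma level_trace_False:
  "(\<forall>q\<in>set (trace p (replicate s False @ u)). level a b q \<le> K) \<longleftrightarrow>
    level a b p \<le> K \<and> (\<forall>q\<in>set (trace (fst p, snd p - int s) u). level a b q \<le> K)"
proof (induction s arbitrary: p)
  case 0
  then show ?case by auto
next
  case (Suc s)
  have "level a b (fst p, snd p - 1) \<le> level a b p" by (simp add: level_def algebra_simps)
  with Suc[of "(fst p, snd p - 1)"] show ?case by (auto simp: algebra_simps)
qed

lemma level_trace_True:
  "(\<forall>q\<in>set (trace p (replicate e True @ u)). level a b q \<le> K) \<longleftrightarrow>
    (\<forall>q\<in>set (trace (fst p + int e, snd p) u). level a b q \<le> K)"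
proof (induction e arbitrary: p)
  case (Suc e)
  have "(\<forall>q\<in>set (trace p (True # v)). level a b q \<le> K) \<longleftrightarrow>
      (\<forall>q\<in>set (trace (fst p + 1, snd p) v). level a b q \<le> K)" for v
  proof -
    have "level a b p \<le> level a b (fst p + 1, snd p)" by (simp add: level_def algebra_simps)
    then show ?thesis by (auto intro: order_trans)
  qed
  from this[of "replicate e True @ u"] Suc[of "(fst p + 1, snd p)"]
  show ?case by (simp add: algebra_simps)
qed auto

lemma level_trace_blocks:
  "(\<forall>q\<in>set (trace p (blocks w)). level a b q \<le> K) \<longleftrightarrow>
    (\<forall>i\<le>length w. level a b p - height a b (block_sum (take i w)) \<le> K)"
proof (induction w arbitrary: p)
  case Nil
  then show ?case by (simp add: block_sum_def height_def)
next
  case (Cons d w)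
  have all: "(\<forall>i\<le>Suc n. Q i) \<longleftrightarrow> Q 0 \<and> (\<forall>i\<le>n. Q (Suc i))" for Q :: "nat \<Rightarrow> bool" and n
    by (metis Suc_le_mono le0 not0_implies_Suc)
  have "level a b (fst p + int (snd d), snd p - int (fst d)) - height a b (block_sum (take i w)) =
      level a b p - height a b (block_sum (d # take i w))" for i
    by (simp add: level_def height_def block_sum_def algebra_simps)
  then show ?case
    by (simp add: all level_trace_False level_trace_True Cons.IH)
       (simp add: block_sum_def height_def)
qed

lemma below_diagonal_blocks:
  "below_diagonal a b (trace (0, int a) (blocks w)) \<longleftrightarrow>
    (\<forall>i\<le>length w. 0 \<le> height a b (block_sum (take i w)))"
  by (simp add: below_diagonal_iff level_trace_blocks) (simp add: level_def algebra_simps)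

text \<open>A final south step would leave from \<open>(b, 1)\<close>, whose level exceeds
  \<open>a * b\<close> by \<open>b\<close>. The assumption on \<open>p\<close> says that the walk
  ends at \<open>(b, 0)\<close>, in a form preserved when the first step is removed.\<close>

lemma last_below_diagonal:
  assumes "below_diagonal a b (trace p u)" "u \<noteq> []" "0 < b"
    and "p = (int b - int (count_list u True), int (count_list u False))"
  shows "last u"
  using assms
proof (induction u arbitrary: p)
  case (Cons d u)
  show ?case
  proof (cases "u = []")
    case True
    with Cons.prems show ?thesis
      by (cases d) (auto simp: below_diagonal_iff level_def algebra_simps)
  next
    case False
    have "last u"
      by (rule Cons.IH[of "if d then (fst p + 1, snd p) else (fst p, snd p - 1)"])
         (use Cons.prems False in \<open>auto simp: below_diagonal_iff split: if_splits\<close>)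
    with False show ?thesis by simp
  qed
qed simp

lemma bij_betw_paths:
  assumes "0 < a" "0 < b"
  shows "bij_betw (\<lambda>w. trace (0, int a) (blocks w)) (dominating a b (Suc r))
    (paths_below_diagonal a b r)"
proof (rule bij_betw_imageI)
  show "inj_on (\<lambda>w. trace (0, int a) (blocks w)) (dominating a b (Suc r))"
    by (auto simp: inj_on_def dominating_def bicompositions_iff dest: trace_inj blocks_inj)
  have "trace (0, int a) (blocks w) \<in> paths_below_diagonal a b r"
    if "w \<in> dominating a b (Suc r)" for w
    using that
    by (auto simp: dominating_def bicompositions_iff paths_below_diagonal_def
        lattice_path_iff_trace count_list_blocks card_ES_turns_trace turns_blocks
        below_diagonal_blocks intro!: exI[of _ "blocks w"])
  moreover have "ps \<in> (\<lambda>w. trace (0, int a) (blocks w)) ` dominating a b (Suc r)"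
    if ps: "ps \<in> paths_below_diagonal a b r" for ps
  proof -
    obtain u where u: "ps = trace (0, int a) u" "count_list u True = b" "count_list u False = a"
      using ps by (auto simp: paths_below_diagonal_def lattice_path_iff_trace)
    have below: "below_diagonal a b (trace (0, int a) u)" and turns: "turns u = r"
      using ps u by (auto simp: paths_below_diagonal_def card_ES_turns_trace)
    have "u \<noteq> []" using u assms by auto
    moreover have "last u"
      by (rule last_below_diagonal[OF below \<open>u \<noteq> []\<close>]) (use assms u in auto)
    \<comment> \<open>An initial east step would reach \<open>(1, a)\<close>, which lies above the
      diagonal.\<close>
    moreover have "\<not> hd u"
    proof
      assume "hd u"
      with \<open>u \<noteq> []\<close> obtain v where "u = True # v" by (cases u) auto
      then have "level a b (1, int a) \<le> int a * int b"
        using below start_in_trace[of "(1, int a)" v] by (auto simp: below_diagonal_iff)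
      with assms show False by (simp add: level_def algebra_simps)
    qed
    ultimately obtain w where w: "u = blocks w" "positive w" using ex_blocks by blast
    \<comment> \<open>For \<open>r = 0\<close> the truncated \<open>length w - 1 = r\<close> would
      also hold for the empty list.\<close>
    have "w \<noteq> []" using w \<open>u \<noteq> []\<close> by auto
    moreover have "length w - 1 = r" using turns w turns_blocks by simp
    ultimately have "length w = Suc r" by (cases w) auto
    moreover have "block_sum w = (a, b)"
      using u w by (simp add: count_list_blocks prod_eq_iff)
    ultimately have "w \<in> dominating a b (Suc r)"
      using w below by (simp add: dominating_def bicompositions_iff below_diagonal_blocks)
    with u w show ?thesis by blast
  qed
  ultimately show "(\<lambda>w. trace (0, int a) (blocks w)) ` dominating a b (Suc r) =
      paths_below_diagonal a b r" by blast
qed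

section \<open>Lean sets\<close>

definition strictly_below :: "nat \<times> nat \<Rightarrow> nat \<times> nat \<Rightarrow> bool" where
  "strictly_below p q \<longleftrightarrow> fst p < fst q \<and> snd p < snd q"

lemma block_sum_Nil [simp]: "block_sum [] = (0, 0)"
  by (simp add: block_sum_def)

lemma block_sum_snoc: "block_sum (w @ [d]) = (fst (block_sum w) + fst d, snd (block_sum w) + snd d)"
  by (simp add: block_sum_def)

lemma block_sum_take_strictly_below:
  "w \<in> bicompositions a b k \<Longrightarrow> i < j \<Longrightarrow> j \<le> k \<Longrightarrow>
    strictly_below (block_sum (take i w)) (block_sum (take j w))"
  by (simp add: strictly_below_def block_sum_take_strict_mono)

lemma block_sum_take_below_end:
  assumes "w \<in> bicompositions a b k" "i < k"
  shows "strictly_below (block_sum (take i w)) (a, b)"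
  using block_sum_take_strictly_below[OF assms(1,2) order_refl] block_sum_bicompositions[OF assms(1)]
    bicompositions_length[OF assms(1)] by simp

text \<open>Strictly increasing first coordinates order the set of prefix points uniquely, and the
  blocks are the differences of consecutive points, the last one ending at
  \<open>(a, b)\<close>.\<close>

lemma bicompositions_eqI:
  assumes w: "w \<in> bicompositions a b k" and v: "v \<in> bicompositions a b k"
    and same: "(\<lambda>i. block_sum (take i w)) ` {..<k} = (\<lambda>i. block_sum (take i v)) ` {..<k}"
  shows "w = v"
proof -
  note len = bicompositions_length[OF w] bicompositions_length[OF v]
  let ?xs = "\<lambda>w. map (\<lambda>i. fst (block_sum (take i w))) [0..<k]"
  have sorted: "sorted_wrt (<) (?xs w)" if "w \<in> bicompositions a b k" for w
    using block_sum_take_strict_mono(1)[OF that] by (simp add: sorted_wrt_iff_nth_less)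
  have "set (?xs w) = fst ` (\<lambda>i. block_sum (take i w)) ` {..<k}" for w
    by (auto simp: atLeast0LessThan)
  then have "set (?xs w) = set (?xs v)" by (simp only: same)
  then have "?xs w = ?xs v"
    by (rule strict_sorted_equal[OF sorted[OF v] sorted[OF w]])
  then have fst_eq: "fst (block_sum (take i w)) = fst (block_sum (take i v))" if "i < k" for i
    using that by simp
  have eq: "block_sum (take i w) = block_sum (take i v)" if i: "i < k" for i
  proof -
    have "block_sum (take i w) \<in> (\<lambda>i. block_sum (take i v)) ` {..<k}"
      unfolding same[symmetric] using i by (intro imageI) simp
    then obtain j where j: "j < k" "block_sum (take i w) = block_sum (take j v)" by auto
    with fst_eq[OF i] have "fst (block_sum (take i v)) = fst (block_sum (take j v))" by simp
    then have "i = j"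
      using block_sum_take_strict_mono(1)[OF v, of i j] block_sum_take_strict_mono(1)[OF v, of j i] i j
      by (cases i j rule: linorder_cases) auto
    with j show ?thesis by simp
  qed
  have eq': "block_sum (take i w) = block_sum (take i v)" if "i \<le> k" for i
    using that eq[of i] len block_sum_bicompositions[OF w] block_sum_bicompositions[OF v]
    by (cases "i = k") auto
  show ?thesis
  proof (rule nth_equalityI)
    fix i assume "i < length w"
    then have i: "i < k" using len by simp
    then show "w ! i = v ! i"
      using eq'[of i] eq'[of "Suc i"] len by (simp add: take_Suc_conv_app_nth block_sum_snoc prod_eq_iff)
  qed (use len in simp)
qed

text \<open>By induction on the chain: removing its largest element \<open>m\<close> leaves a chain below \<open>m\<close>.\<close>

lemma ex_bicomposition_of_chain:
  assumes "finite C" "(0, 0) \<in> C"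
    and "\<And>p q. p \<in> C \<Longrightarrow> q \<in> C \<Longrightarrow> p \<noteq> q \<Longrightarrow> strictly_below p q \<or> strictly_below q p"
    and "\<And>p. p \<in> C \<Longrightarrow> strictly_below p (a, b)"
  shows "\<exists>w \<in> bicompositions a b (card C). (\<lambda>i. block_sum (take i w)) ` {..<card C} = C"
  using assms
proof (induction "card C" arbitrary: C a b)
  case 0
  then show ?case by auto
next
  case (Suc n)
  have "Max (fst ` C) \<in> fst ` C" using Suc.prems by (intro Max_in) auto
  then obtain m where m: "m \<in> C" "fst m = Max (fst ` C)" by auto
  have below_m: "strictly_below p m" if "p \<in> C - {m}" for p
  proof -
    have "fst p \<le> fst m" using that m Suc.prems(1) by simp
    then show ?thesis using Suc.prems(3)[of p m] that m by (auto simp: strictly_below_def)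
  qed
  have m_below: "strictly_below m (a, b)" using Suc.prems(4) m by blast
  let ?C = "C - {m}"
  have card: "card ?C = n" using Suc.hyps(2) m Suc.prems(1) by simp
  have "\<exists>w \<in> bicompositions (fst m) (snd m) n. (\<lambda>i. block_sum (take i w)) ` {..<n} = ?C"
  proof (cases "m = (0, 0)")
    case True
    then have "?C = {}" using below_m by (auto simp: strictly_below_def)
    with card have "n = 0" by simp
    with \<open>?C = {}\<close> True show ?thesis by (auto simp: bicompositions_iff)
  next
    case False
    have "\<exists>w \<in> bicompositions (fst m) (snd m) (card ?C). (\<lambda>i. block_sum (take i w)) ` {..<card ?C} = ?C"
      using False Suc.prems below_m card by (intro Suc.hyps(1)) auto
    with card show ?thesis by simp
  qed
  then obtain w where w: "w \<in> bicompositions (fst m) (snd m) n"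
    "(\<lambda>i. block_sum (take i w)) ` {..<n} = ?C" by blast
  \<comment> \<open>The added block leads from \<open>m\<close> to \<open>(a, b)\<close>; both
    entries are positive since \<open>m\<close> is strictly below.\<close>
  let ?w = "w @ [(a - fst m, b - snd m)]"
  have mem: "?w \<in> bicompositions a b (Suc n)"
    using w(1) m_below by (auto simp: bicompositions_iff positive_def block_sum_snoc strictly_below_def)
  have image: "(\<lambda>i. block_sum (take i ?w)) ` {..<Suc n} = C"
  proof -
    have "length w = n" using w(1) by (rule bicompositions_length)
    then have "(\<lambda>i. block_sum (take i ?w)) ` {..<Suc n} =
        insert (block_sum w) ((\<lambda>i. block_sum (take i w)) ` {..<n})"
      by (simp add: lessThan_Suc)
    also have "\<dots> = insert m ?C"
      unfolding w(2) block_sum_bicompositions[OF w(1)] by simp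
    finally show ?thesis using m(1) by (simp add: insert_absorb)
  qed
  show ?case
    unfolding Suc.hyps(2)[symmetric] using image mem by (intro bexI[of _ ?w])
qed

text \<open>Writing the difference as \<open>x * a + y * b\<close> and using coprimality gives
  \<open>fst p - fst q - y = a * t\<close> and \<open>x + snd p - snd q = b * t\<close>. The box
  bounds leave only \<open>t = 0\<close>, so \<open>y\<close> and \<open>x\<close> are the
  coordinate differences.\<close>

lemma height_diff_in_semigroup2_iff:
  assumes cop: "coprime a b" and pq: "strictly_below p (a, b)" "strictly_below q (a, b)"
    and le: "height a b q \<le> height a b p"
  shows "nat (height a b p - height a b q) \<in> semigroup2 a b \<longleftrightarrow>
    fst q \<le> fst p \<and> snd p \<le> snd q"
proof
  assume "nat (height a b p - height a b q) \<in> semigroup2 a b"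
  then obtain x y where "nat (height a b p - height a b q) = x * a + y * b"
    by (auto simp: semigroup2_def)
  then have "height a b p - height a b q = int (x * a + y * b)"
    using le by linarith
  then have eq: "int b * (int (fst p) - int (fst q) - int y) =
      int a * (int x + int (snd p) - int (snd q))"
    by (simp add: height_def algebra_simps)
  then have "int a dvd int (fst p) - int (fst q) - int y"
    using cop by (metis coprime_dvd_mult_right_iff coprime_int_iff dvd_triv_left)
  then obtain t where t: "int (fst p) - int (fst q) - int y = int a * t" by (elim dvdE)
  have pos: "0 < a" "0 < b" using pq by (auto simp: strictly_below_def)
  have "int a * (int b * t) = int a * (int x + int (snd p) - int (snd q))"
    using eq t by (simp add: algebra_simps)
  then have t': "int x + int (snd p) - int (snd q) = int b * t"
    using pos by simp
  have "\<not> 0 < t"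
  proof
    assume "0 < t"
    then have "int a * 1 \<le> int a * t" by (intro mult_left_mono) auto
    with t pq show False by (auto simp: strictly_below_def)
  qed
  moreover have "\<not> t < 0"
  proof
    assume "t < 0"
    then have "int b * t \<le> int b * (-1)" by (intro mult_left_mono) auto
    with t' pq show False by (auto simp: strictly_below_def)
  qed
  ultimately show "fst q \<le> fst p \<and> snd p \<le> snd q" using t t' by simp
next
  assume "fst q \<le> fst p \<and> snd p \<le> snd q"
  then obtain m n where "fst p = fst q + n" "snd q = snd p + m"
    by (auto simp: le_iff_add)
  then have "height a b p - height a b q = int (m * a + n * b)"
    by (simp add: height_def algebra_simps)
  then have "nat (height a b p - height a b q) = m * a + n * b"
    by (metis nat_int)
  then show "nat (height a b p - height a b q) \<in> semigroup2 a b"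
    unfolding semigroup2_def by blast
qed

text \<open>If \<open>p\<close> is at least as high as \<open>q\<close>, then
  \<open>fst p < fst q\<close> forces \<open>snd p < snd q\<close>, and \<open>snd q < snd p\<close>
  forces \<open>fst q < fst p\<close>. So failure of the criterion above means strict
  comparability.\<close>

lemma abs_height_diff_notin_semigroup2_iff:
  assumes cop: "coprime a b" and pq: "strictly_below p (a, b)" "strictly_below q (a, b)"
  shows "nat \<bar>height a b p - height a b q\<bar> \<notin> semigroup2 a b \<longleftrightarrow>
    strictly_below p q \<or> strictly_below q p"
proof -
  have *: "nat (height a b p - height a b q) \<notin> semigroup2 a b \<longleftrightarrow>
      strictly_below p q \<or> strictly_below q p"
    if pq: "strictly_below p (a, b)" "strictly_below q (a, b)"
      and le: "height a b q \<le> height a b p" for p q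
  proof -
    have pos: "0 < a" "0 < b" using pq by (auto simp: strictly_below_def)
    have "snd p < snd q" if "fst p < fst q"
    proof (rule ccontr)
      assume "\<not> snd p < snd q"
      then have "int a * int (snd q) \<le> int a * int (snd p)" by (intro mult_left_mono) auto
      moreover have "int b * int (fst p) < int b * int (fst q)"
        using that pos by (intro mult_strict_left_mono) auto
      ultimately show False using le by (simp add: height_def)
    qed
    moreover have "fst q < fst p" if "snd q < snd p"
    proof (rule ccontr)
      assume "\<not> fst q < fst p"
      then have "int b * int (fst p) \<le> int b * int (fst q)" by (intro mult_left_mono) auto
      moreover have "int a * int (snd q) < int a * int (snd p)"
        using that pos by (intro mult_strict_left_mono) auto
      ultimately show False using le by (simp add: height_def)
    qed
    ultimately show ?thesis
      using height_diff_in_semigroup2_iff[OF cop pq le] by (auto simp: strictly_below_def)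
  qed
  show ?thesis
  proof (cases "height a b q \<le> height a b p")
    case True
    with *[OF pq] show ?thesis by simp
  next
    case False
    with *[OF pq(2,1)] show ?thesis by (auto simp: abs_minus_commute)
  qed
qed

text \<open>Some \<open>e < b\<close> makes \<open>x + a * e\<close> a multiple
  \<open>b * s\<close>. If \<open>s\<close> were at least \<open>a\<close>, then
  \<open>x = a * (b - e) + b * (s - a)\<close> would lie in the semigroup.\<close>

lemma ex_height_eq:
  assumes cop: "coprime a b" and pos: "0 < a" "0 < b"
    and x: "x = 0 \<or> x \<notin> semigroup2 a b"
  shows "\<exists>p. strictly_below p (a, b) \<and> height a b p = int x"
proof (cases "x = 0")
  case True
  with pos show ?thesis by (intro exI[of _ "(0, 0)"]) (simp add: strictly_below_def height_def)
next
  case False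
  have "gcd (int a) (int b) = 1" using cop by (simp add: coprime_iff_gcd_eq_1)
  then obtain u v where uv: "u * int a + v * int b = 1" using bezout_int by metis
  \<comment> \<open>By Bezout \<open>u\<close> inverts \<open>a\<close> modulo \<open>b\<close>, so
    \<open>e\<close> solves \<open>a * e = - x\<close> modulo \<open>b\<close>.\<close>
  define e where "e = nat ((- int x * u) mod int b)"
  have e: "int e = (- int x * u) mod int b" "e < b"
    using pos by (auto simp: e_def nat_less_iff)
  define k where "k = (- int x * u) div int b"
  have e_eq: "int e = - int x * u - int b * k"
    by (simp add: e(1) k_def minus_mult_div_eq_mod)
  have "int x + int a * int e = int x * (1 - u * int a) - int a * int b * k"
    by (simp add: e_eq algebra_simps)
  also have "1 - u * int a = v * int b" using uv by simp
  finally have "int x + int a * int e = int b * (int x * v - int a * k)"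
    by (simp add: algebra_simps)
  then have "int b dvd int x + int a * int e" by (rule dvdI)
  then have "b dvd x + a * e" by (metis of_nat_add of_nat_dvd_iff of_nat_mult)
  then obtain s where s: "x + a * e = b * s" by (elim dvdE)
  have "s < a"
  proof (rule ccontr)
    assume "\<not> s < a"
    then obtain m n where "s = a + m" "b = e + n"
      using e(2) by (metis le_Suc_ex less_imp_le not_less)
    with s have "x = n * a + m * b" by (simp add: algebra_simps)
    then have "x \<in> semigroup2 a b" unfolding semigroup2_def by blast
    with x False show False by simp
  qed
  with e s show ?thesis
    using arg_cong[OF s, of int]
    by (intro exI[of _ "(s, e)"]) (simp add: strictly_below_def height_def)
qed

text \<open>The full prefix is left out because its point \<open>(a, b)\<close> has height 0 again,
  like the origin. On dominating lists \<open>nat\<close> loses nothing.\<close>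

definition prefix_heights :: "nat \<Rightarrow> nat \<Rightarrow> (nat \<times> nat) list \<Rightarrow> nat set" where
  "prefix_heights a b w = (\<lambda>i. nat (height a b (block_sum (take i w)))) ` {..<length w}"

lemma bij_betw_lean_sets:
  assumes cop: "coprime a b" and pos: "0 < a" "0 < b"
  shows "bij_betw (prefix_heights a b) (dominating a b (Suc r)) (lean_sets (semigroup2 a b) r)"
proof (rule bij_betw_imageI)
  let ?k = "Suc r"
  let ?h = "\<lambda>p. nat (height a b p)"
  let ?C = "\<lambda>w. (\<lambda>i. block_sum (take i w)) ` {..<?k}"
  \<comment> \<open>On \<open>B\<close> the height is injective, its values include 0 and all gaps,
    and lean sets correspond to chains through the origin.\<close>
  define B where "B = {p. strictly_below p (a, b) \<and> 0 \<le> height a b p}"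
  have inj: "inj_on ?h B"
  proof (rule inj_onI)
    fix p q assume "p \<in> B" "q \<in> B" "?h p = ?h q"
    then show "p = q"
      using pos by (intro height_inj_on_box[OF cop, of p q])
        (auto simp: B_def strictly_below_def eq_nat_nat_iff)
  qed
  have heights: "prefix_heights a b w = ?h ` ?C w" and in_B: "?C w \<subseteq> B"
    if "w \<in> dominating a b ?k" for w
    using that block_sum_take_below_end[of w a b ?k] bicompositions_length[of w a b ?k]
    by (auto simp: dominating_def prefix_heights_def B_def)
  show "inj_on (prefix_heights a b) (dominating a b ?k)"
  proof (rule inj_onI)
    fix w v assume wv: "w \<in> dominating a b ?k" "v \<in> dominating a b ?k"
      "prefix_heights a b w = prefix_heights a b v"
    then have "?h ` ?C w = ?h ` ?C v" by (simp only: heights)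
    then have "?C w = ?C v"
      using inj_on_image_eq_iff[OF inj in_B[OF wv(1)] in_B[OF wv(2)]] by simp
    then show "w = v" using wv by (intro bicompositions_eqI) (auto simp: dominating_def)
  qed
  have incomparable: "nat \<bar>int (?h p) - int (?h q)\<bar> \<notin> semigroup2 a b \<longleftrightarrow>
      strictly_below p q \<or> strictly_below q p" if "p \<in> B" "q \<in> B" for p q
    using that abs_height_diff_notin_semigroup2_iff[OF cop, of p q] by (simp add: B_def)
  have zero_B: "(0, 0) \<in> B" "?h (0, 0) = 0"
    using pos by (auto simp: B_def strictly_below_def height_def)
  have "prefix_heights a b w \<in> lean_sets (semigroup2 a b) r" if w: "w \<in> dominating a b ?k" for w
  proof -
    have W: "w \<in> bicompositions a b ?k" using w by (simp add: dominating_def)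
    have chain: "strictly_below p q \<or> strictly_below q p"
      if pq: "p \<in> ?C w" "q \<in> ?C w" "p \<noteq> q" for p q
    proof -
      obtain i j where ij: "i < ?k" "p = block_sum (take i w)" "j < ?k" "q = block_sum (take j w)"
        using pq(1,2) by auto
      with \<open>p \<noteq> q\<close> show ?thesis
        using block_sum_take_strictly_below[OF W, of i j] block_sum_take_strictly_below[OF W, of j i]
        by (cases i j rule: linorder_cases) auto
    qed
    have zero: "0 \<in> prefix_heights a b w"
    proof -
      have "?h (block_sum (take 0 w)) \<in> ?h ` ?C w" by (intro imageI) simp
      then show ?thesis using zero_B by (simp add: heights[OF w])
    qed
    have "inj_on (\<lambda>i. block_sum (take i w)) {..<?k}"
      using block_sum_take_strict_mono(1)[OF W]
      by (intro linorder_inj_onI linear) (metis lessThan_iff less_imp_le less_irrefl)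
    then have "card (?C w) = ?k" by (simp add: card_image)
    then have "card (prefix_heights a b w) = ?k"
      using inj_on_subset[OF inj in_B[OF w]] heights[OF w] by (simp add: card_image)
    moreover have "lean (semigroup2 a b) (prefix_heights a b w)"
      unfolding lean_def
    proof (intro conjI ballI impI)
      fix x y assume xy: "x \<in> prefix_heights a b w" "y \<in> prefix_heights a b w" "x \<noteq> y"
      obtain p where p: "p \<in> ?C w" "x = ?h p" using xy(1) unfolding heights[OF w] by (rule imageE)
      obtain q where q: "q \<in> ?C w" "y = ?h q" using xy(2) unfolding heights[OF w] by (rule imageE)
      have "p \<noteq> q" using p q xy(3) by auto
      then show "nat \<bar>int x - int y\<bar> \<notin> semigroup2 a b"
        unfolding p(2) q(2)
        using incomparable[OF subsetD[OF in_B[OF w] p(1)] subsetD[OF in_B[OF w] q(1)]]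
          chain[OF p(1) q(1)] by simp
    qed (use zero in \<open>simp_all add: prefix_heights_def\<close>)
    ultimately show ?thesis using zero by (simp add: lean_sets_def)
  qed
  moreover have "X \<in> prefix_heights a b ` dominating a b ?k"
    if X: "X \<in> lean_sets (semigroup2 a b) r" for X
  proof -
    have lean: "finite X" "0 \<in> X"
      "\<And>x y. x \<in> X \<Longrightarrow> y \<in> X \<Longrightarrow> x \<noteq> y \<Longrightarrow> nat \<bar>int x - int y\<bar> \<notin> semigroup2 a b"
      using X by (auto simp: lean_sets_def lean_def)
    have cardX: "card X = ?k"
      using X lean(1,2) card_Suc_Diff1[of X 0] by (simp add: lean_sets_def)
    have "x \<in> ?h ` B" if "x \<in> X" for x
    proof -
      \<comment> \<open>Comparison with the element 0 of \<open>X\<close> shows that a nonzero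
        \<open>x\<close> is a gap.\<close>
      have "x = 0 \<or> x \<notin> semigroup2 a b" using lean(3)[of x 0] lean(2) that by auto
      then obtain p where "strictly_below p (a, b)" "height a b p = int x"
        using ex_height_eq[OF cop pos] by blast
      then show ?thesis by (intro image_eqI[of _ _ p]) (simp_all add: B_def)
    qed
    then have "X \<subseteq> ?h ` B" by blast
    then obtain C where C: "C \<subseteq> B" "X = ?h ` C" by (auto simp: subset_image_iff)
    have injC: "inj_on ?h C" using inj C(1) by (rule inj_on_subset)
    have finC: "finite C" and cardC: "card C = ?k"
      using C(2) lean(1) cardX injC by (auto simp: finite_image_iff card_image)
    have zeroC: "(0, 0) \<in> C"
    proof -
      obtain p where "p \<in> C" "?h p = 0" using lean(2) C(2) by auto
      then have "p = (0, 0)"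
        using inj_onD[OF inj, of p "(0, 0)"] zero_B C(1) by auto
      with \<open>p \<in> C\<close> show ?thesis by simp
    qed
    have chain: "strictly_below p q \<or> strictly_below q p" if "p \<in> C" "q \<in> C" "p \<noteq> q" for p q
    proof -
      have "?h p \<noteq> ?h q" using inj_onD[OF injC _ that(1,2)] that(3) by blast
      then have "nat \<bar>int (?h p) - int (?h q)\<bar> \<notin> semigroup2 a b"
        using that by (intro lean(3)) (simp_all add: C(2))
      then show ?thesis using incomparable C(1) that by blast
    qed
    have "\<And>p. p \<in> C \<Longrightarrow> strictly_below p (a, b)" using C by (auto simp: B_def)
    from ex_bicomposition_of_chain[OF finC zeroC chain this]
    obtain w where w: "w \<in> bicompositions a b ?k" "?C w = C"
      using cardC by auto
    have "0 \<le> height a b (block_sum (take i w))" if "i \<le> ?k" for i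
    proof (cases "i = ?k")
      case True
      then show ?thesis
        using w(1) by (simp add: bicompositions_length block_sum_bicompositions height_def)
    next
      case False
      with that have "block_sum (take i w) \<in> B" using w(2) C(1) by auto
      then show ?thesis by (simp add: B_def)
    qed
    with w have "w \<in> dominating a b ?k" by (simp add: dominating_def)
    moreover from this have "prefix_heights a b w = X" using heights w(2) C(2) by simp
    ultimately show ?thesis by blast
  qed
  ultimately show "prefix_heights a b ` dominating a b ?k = lean_sets (semigroup2 a b) r" by blast
qed

section \<open>Isomorphism classes of semimodules\<close>

lemma zero_in_semigroup2: "0 \<in> semigroup2 a b"
  by (auto simp: semigroup2_def)

lemma add_in_semigroup2:
  assumes "x \<in> semigroup2 a b" "y \<in> semigroup2 a b"
  shows "x + y \<in> semigroup2 a b"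
proof -
  obtain i j k l where "x = i * a + j * b" "y = k * a + l * b"
    using assms by (auto simp: semigroup2_def)
  then have "x + y = (i + k) * a + (j + l) * b" by (simp add: algebra_simps)
  then show ?thesis unfolding semigroup2_def by blast
qed

section \<open>Generators of semimodules over a submonoid of the naturals\<close>

locale submonoid =
  fixes \<Gamma> :: "nat set"
  assumes zero: "0 \<in> \<Gamma>" and add: "x \<in> \<Gamma> \<Longrightarrow> y \<in> \<Gamma> \<Longrightarrow> x + y \<in> \<Gamma>"
begin

definition generated :: "nat set \<Rightarrow> nat set" where
  "generated E = (\<Union>x\<in>E. (+) x ` \<Gamma>)"

lemma mem_generated: "z \<in> generated E \<longleftrightarrow> (\<exists>x\<in>E. \<exists>g\<in>\<Gamma>. z = x + g)"
  by (auto simp: generated_def)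

lemma generated_superset: "E \<subseteq> generated E"
  using zero by (force simp: mem_generated)

lemma generated_mono: "F \<subseteq> E \<Longrightarrow> generated F \<subseteq> generated E"
  by (auto simp: generated_def)

lemma generates_iff: "generates \<Gamma> E \<Delta> \<longleftrightarrow> generated E = \<Delta>"
  using generated_superset[of E] by (auto simp: generates_def generated_def)

lemma semimodule_generated:
  assumes "E \<noteq> {}"
  shows "semimodule \<Gamma> (generated E)"
  unfolding semimodule_def
proof (intro conjI ballI)
  show "generated E \<noteq> {}" using assms generated_superset[of E] by blast
  fix x g assume "x \<in> generated E" "g \<in> \<Gamma>"
  then obtain y h where "y \<in> E" "h + g \<in> \<Gamma>" "x = y + h"
    using add by (auto simp: mem_generated)
  then show "x + g \<in> generated E" unfolding mem_generated by (metis add.assoc)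
qed

text \<open>A generator is redundant exactly when it lies in \<open>y + \<Gamma>\<close> for another
  generator \<open>y\<close>.\<close>

lemma minimally_generates_iff:
  "minimally_generates \<Gamma> E \<Delta> \<longleftrightarrow>
    generated E = \<Delta> \<and> (\<forall>x\<in>E. \<forall>y\<in>E. x \<noteq> y \<longrightarrow> nat \<bar>int x - int y\<bar> \<notin> \<Gamma>)"
proof -
  have "(\<forall>F. F \<subset> E \<longrightarrow> generated F \<noteq> generated E) \<longleftrightarrow>
      (\<forall>x\<in>E. \<forall>y\<in>E. x \<noteq> y \<longrightarrow> nat \<bar>int x - int y\<bar> \<notin> \<Gamma>)"
  proof (intro iffI ballI allI impI notI)
    have "False" if min: "\<forall>F. F \<subset> E \<longrightarrow> generated F \<noteq> generated E"
      and xy: "x \<in> E" "y \<in> E" "y < x" "x - y \<in> \<Gamma>" for x y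
    proof -
      have "z \<in> generated (E - {x})" if "z \<in> generated E" for z
      proof -
        obtain e g where eg: "e \<in> E" "g \<in> \<Gamma>" "z = e + g" using \<open>z \<in> generated E\<close> by (auto simp: mem_generated)
        show ?thesis
        proof (cases "e = x")
          case True
          then have "z = y + ((x - y) + g)" using eg xy by simp
          moreover have "(x - y) + g \<in> \<Gamma>" using eg xy add by blast
          moreover have "y \<in> E - {x}" using xy by simp
          ultimately show ?thesis unfolding mem_generated by blast
        next
          case False
          with eg show ?thesis by (auto simp: mem_generated)
        qed
      qed
      then have "generated (E - {x}) = generated E" using generated_mono[of "E - {x}" E] by blast
      with min xy(1) show False by blast
    qed
    note * = this
    fix x y assume "\<forall>F. F \<subset> E \<longrightarrow> generated F \<noteq> generated E" "x \<in> E" "y \<in> E" "x \<noteq> y"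
      "nat \<bar>int x - int y\<bar> \<in> \<Gamma>"
    then show False
      using *[of x y] *[of y x] by (cases x y rule: linorder_cases) (auto simp: nat_diff_distrib)
  next
    fix F assume lean: "\<forall>x\<in>E. \<forall>y\<in>E. x \<noteq> y \<longrightarrow> nat \<bar>int x - int y\<bar> \<notin> \<Gamma>"
      and F: "F \<subset> E" "generated F = generated E"
    then obtain x where x: "x \<in> E" "x \<notin> F" by blast
    then have "x \<in> generated F" using F generated_superset by blast
    then obtain y g where yg: "y \<in> F" "g \<in> \<Gamma>" "x = y + g" by (auto simp: mem_generated)
    then have "nat \<bar>int x - int y\<bar> \<in> \<Gamma>" by simp
    moreover have "y \<in> E" "x \<noteq> y" using yg(1) F(1) x(2) by auto
    ultimately show False using lean x(1) by blast
  qed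
  then show ?thesis unfolding minimally_generates_def generates_iff by blast
qed

text \<open>An \<open>x\<close> in \<open>E\<close> is \<open>y + g\<close> with \<open>y\<close> in
  \<open>F\<close>, and \<open>y\<close> is \<open>z + h\<close> with \<open>z\<close> in
  \<open>E\<close>. Minimality of \<open>E\<close> forces \<open>x = z\<close>, so \<open>g\<close>
  and \<open>h\<close> vanish and \<open>x = y\<close>.\<close>

lemma minimal_generators_unique:
  assumes "minimally_generates \<Gamma> E \<Delta>" "minimally_generates \<Gamma> F \<Delta>"
  shows "E = F"
proof -
  have "E \<subseteq> F" if E: "minimally_generates \<Gamma> E \<Delta>" and F: "minimally_generates \<Gamma> F \<Delta>" for E F
  proof
    fix x assume x: "x \<in> E"
    have generated: "generated E = \<Delta>" "generated F = \<Delta>" using E F by (auto simp: minimally_generates_iff)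
    have "x \<in> generated F" using x generated generated_superset[of E] by blast
    then obtain y g where y: "y \<in> F" "g \<in> \<Gamma>" "x = y + g" by (auto simp: mem_generated)
    have "y \<in> generated E" using y(1) generated generated_superset[of F] by blast
    then obtain z h where z: "z \<in> E" "h \<in> \<Gamma>" "y = z + h" by (auto simp: mem_generated)
    have "nat \<bar>int x - int z\<bar> = h + g" using y z by simp
    then have "nat \<bar>int x - int z\<bar> \<in> \<Gamma>" using y z add by simp
    then have "x = z" using E x z(1) unfolding minimally_generates_iff by blast
    with y z show "x \<in> F" by simp
  qed
  with assms show ?thesis by blast
qed

section \<open>Isomorphism classes and their normalised representatives\<close>

lemma semimodule_iso_iff:
  "(\<Delta>, \<Delta>') \<in> semimodule_iso \<Gamma> \<longleftrightarrow>
    semimodule \<Gamma> \<Delta> \<and> semimodule \<Gamma> \<Delta>' \<and> (\<exists>c. (\<lambda>x. int x + c) ` \<Delta> = int ` \<Delta>')"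
  by (auto simp: semimodule_iso_def bij_betw_def inj_on_def)

lemma equiv_semimodule_iso: "equiv (Collect (semimodule \<Gamma>)) (semimodule_iso \<Gamma>)"
proof (rule equivI)
  show "semimodule_iso \<Gamma> \<subseteq> Collect (semimodule \<Gamma>) \<times> Collect (semimodule \<Gamma>)"
    by (auto simp: semimodule_iso_iff)
  show "refl_on (Collect (semimodule \<Gamma>)) (semimodule_iso \<Gamma>)"
    by (auto simp: refl_on_def semimodule_iso_iff intro!: exI[of _ 0])
  show "sym (semimodule_iso \<Gamma>)"
  proof (rule symI)
    fix A B assume AB: "(A, B) \<in> semimodule_iso \<Gamma>"
    then obtain c where "(\<lambda>x. int x + c) ` A = int ` B" by (auto simp: semimodule_iso_iff)
    then have "(\<lambda>x. x - c) ` (\<lambda>x. int x + c) ` A = (\<lambda>x. x - c) ` int ` B" by simp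
    then have "(\<lambda>x. int x + (- c)) ` B = int ` A" by (simp add: image_image)
    with AB show "(B, A) \<in> semimodule_iso \<Gamma>" unfolding semimodule_iso_iff by blast
  qed
  show "trans (semimodule_iso \<Gamma>)"
  proof (rule transI)
    fix A B D assume AB: "(A, B) \<in> semimodule_iso \<Gamma>" "(B, D) \<in> semimodule_iso \<Gamma>"
    then obtain c d where "(\<lambda>x. int x + c) ` A = int ` B" "(\<lambda>x. int x + d) ` B = int ` D"
      by (auto simp: semimodule_iso_iff)
    then have "(\<lambda>x. x + d) ` (\<lambda>x. int x + c) ` A = int ` D" by (simp add: image_image)
    then have "(\<lambda>x. int x + (c + d)) ` A = int ` D" by (simp add: image_image add.assoc)
    with AB show "(A, D) \<in> semimodule_iso \<Gamma>" unfolding semimodule_iso_iff by blast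
  qed
qed

text \<open>The image of 0 is \<open>c\<close>, so \<open>c\<close> is nonnegative; 0 is itself an
  image, so \<open>c\<close> is not positive.\<close>

lemma semimodule_iso_eq:
  assumes "(\<Delta>, \<Delta>') \<in> semimodule_iso \<Gamma>" "0 \<in> \<Delta>" "0 \<in> \<Delta>'"
  shows "\<Delta> = \<Delta>'"
proof -
  obtain c where c: "(\<lambda>x. int x + c) ` \<Delta> = int ` \<Delta>'"
    using assms by (auto simp: semimodule_iso_iff)
  have "int 0 + c \<in> int ` \<Delta>'" "int 0 \<in> (\<lambda>x. int x + c) ` \<Delta>"
    using assms(2,3) c by blast+
  then have "c = 0" by auto
  with c show ?thesis by (simp add: inj_image_eq_iff)
qed

lemma bij_betw_semimodule_classes:
  "bij_betw (\<lambda>X. semimodule_iso \<Gamma> `` {generated X}) (lean_sets \<Gamma> r) (semimodule_classes \<Gamma> (Suc r))"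
proof (rule bij_betw_imageI)
  have lean: "minimally_generates \<Gamma> X (generated X)" "semimodule \<Gamma> (generated X)" "0 \<in> generated X" "finite X"
    "card X = Suc r" if "X \<in> lean_sets \<Gamma> r" for X
  proof -
    have X: "finite X" "0 \<in> X" "card (X - {0}) = r"
      using that by (auto simp: lean_sets_def lean_def)
    then show "semimodule \<Gamma> (generated X)" "0 \<in> generated X" "finite X"
      using generated_superset[of X] semimodule_generated[of X] by auto
    show "minimally_generates \<Gamma> X (generated X)"
      using that by (simp add: minimally_generates_iff lean_sets_def lean_def)
    show "card X = Suc r" using X card_Suc_Diff1[of X 0] by simp
  qed
  show "inj_on (\<lambda>X. semimodule_iso \<Gamma> `` {generated X}) (lean_sets \<Gamma> r)"
  proof (rule inj_onI)
    fix X Y assume XY: "X \<in> lean_sets \<Gamma> r" "Y \<in> lean_sets \<Gamma> r"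
      "semimodule_iso \<Gamma> `` {generated X} = semimodule_iso \<Gamma> `` {generated Y}"
    then have "(generated X, generated Y) \<in> semimodule_iso \<Gamma>"
      using eq_equiv_class[OF XY(3) equiv_semimodule_iso] lean(2)[OF XY(2)] by simp
    then have "generated X = generated Y"
      by (rule semimodule_iso_eq[OF _ lean(3)[OF XY(1)] lean(3)[OF XY(2)]])
    then show "X = Y"
      using minimal_generators_unique[of X "generated X" Y] lean(1)[OF XY(1)] lean(1)[OF XY(2)] by simp
  qed
  have "semimodule_iso \<Gamma> `` {generated X} \<in> semimodule_classes \<Gamma> (Suc r)" if "X \<in> lean_sets \<Gamma> r" for X
    unfolding semimodule_classes_def using lean[OF that]
    by (intro quotientI CollectI conjI exI[of _ X])
  moreover have "A \<in> (\<lambda>X. semimodule_iso \<Gamma> `` {generated X}) ` lean_sets \<Gamma> r"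
    if A_class: "A \<in> semimodule_classes \<Gamma> (Suc r)" for A
  proof -
    obtain \<Delta> where A: "A = semimodule_iso \<Gamma> `` {\<Delta>}"
      and "\<Delta> \<in> {\<Delta>. semimodule \<Gamma> \<Delta> \<and>
        (\<exists>E. finite E \<and> card E = Suc r \<and> minimally_generates \<Gamma> E \<Delta>)}"
      using A_class unfolding semimodule_classes_def by (rule quotientE)
    then obtain E where \<Delta>: "semimodule \<Gamma> \<Delta>"
      and E: "finite E" "card E = Suc r" "minimally_generates \<Gamma> E \<Delta>"
      by blast
    \<comment> \<open>Translating by the least generator puts 0 into the generating set; subtraction
      of \<open>m\<close> is exact on \<open>E\<close>.\<close>
    define m where "m = Min E"
    have "E \<noteq> {}" using E by auto
    then have m: "m \<in> E" "\<And>x. x \<in> E \<Longrightarrow> m \<le> x" using E(1) by (auto simp: m_def)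
    define X where "X = (\<lambda>x. x - m) ` E"
    have "inj_on (\<lambda>x. x - m) E"
      using m(2) by (intro inj_onI) (metis le_add_diff_inverse)
    then have "card X = Suc r" using E by (simp add: X_def card_image)
    moreover have "0 \<in> X" "finite X" using m E by (auto simp: X_def)
    moreover have "\<forall>x\<in>X. \<forall>y\<in>X. x \<noteq> y \<longrightarrow> nat \<bar>int x - int y\<bar> \<notin> \<Gamma>"
      using E(3) m(2) by (auto simp: X_def minimally_generates_iff)
    ultimately have X: "X \<in> lean_sets \<Gamma> r" by (simp add: lean_sets_def lean_def)
    have E_X: "E = (\<lambda>x. x + m) ` X" using m(2) by (simp add: X_def image_image)
    have "\<Delta> = generated E" using E by (simp add: minimally_generates_iff)
    also have "\<dots> = (\<lambda>x. x + m) ` generated X"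
      unfolding generated_def E_X by (simp add: image_UN image_image add_ac)
    finally have "int ` \<Delta> = (\<lambda>x. int x + int m) ` generated X" by (simp add: image_image)
    then have "(generated X, \<Delta>) \<in> semimodule_iso \<Gamma>"
      unfolding semimodule_iso_iff using lean(2)[OF X] \<Delta>
      by (intro conjI exI[of _ "int m"]) simp_all
    then have "semimodule_iso \<Gamma> `` {generated X} = A"
      unfolding A by (rule equiv_class_eq[OF equiv_semimodule_iso])
    with X show ?thesis by blast
  qed
  ultimately show "(\<lambda>X. semimodule_iso \<Gamma> `` {generated X}) ` lean_sets \<Gamma> r =
      semimodule_classes \<Gamma> (Suc r)" by blast
qed

end

theorem theorem3p6:
  fixes \<alpha> \<beta> r :: nat
  assumes "\<alpha> > 0" and "\<beta> > 0" and "gcd \<alpha> \<beta> = 1"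
  shows "(finite (semimodule_classes (semigroup2 \<alpha> \<beta>) (r + 1)) \<and>
          real (card (semimodule_classes (semigroup2 \<alpha> \<beta>) (r + 1))) = L \<alpha> \<beta> r) \<and>
         (finite (lean_sets (semigroup2 \<alpha> \<beta>) r) \<and>
          real (card (lean_sets (semigroup2 \<alpha> \<beta>) r)) = L \<alpha> \<beta> r) \<and>
         (finite (paths_below_diagonal \<alpha> \<beta> r) \<and>
          real (card (paths_below_diagonal \<alpha> \<beta> r)) = L \<alpha> \<beta> r)"
proof -
  have cop: "coprime \<alpha> \<beta>" using assms(3) by (simp add: coprime_iff_gcd_eq_1)
  interpret submonoid "semigroup2 \<alpha> \<beta>"
    by standard (rule zero_in_semigroup2, rule add_in_semigroup2)
  let ?W = "dominating \<alpha> \<beta> (Suc r)"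
  have fin: "finite ?W" and card: "Suc r * card ?W = ((\<alpha> - 1) choose r) * ((\<beta> - 1) choose r)"
    using finite_card_dominating[OF cop assms(1,2)] by auto
  have "(real r + 1) * real (card ?W) = real ((\<alpha> - 1) choose r) * real ((\<beta> - 1) choose r)"
    using arg_cong[OF card, of real] by (simp add: algebra_simps)
  then have L: "real (card ?W) = L \<alpha> \<beta> r"
    by (simp add: L_def field_simps)
  \<comment> \<open>All three families are counted by bijections with \<open>?W\<close>; the
    semimodule classes are reached through the lean sets.\<close>
  have transfer: "finite S \<and> real (card S) = L \<alpha> \<beta> r" if "bij_betw f ?W S" for f and S :: "'a set"
    using that fin L bij_betw_finite[OF that] bij_betw_same_card[OF that] by simp
  note lean = bij_betw_lean_sets[OF cop assms(1,2), of r]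
  show ?thesis
    using transfer[OF bij_betw_trans[OF lean bij_betw_semimodule_classes]] transfer[OF lean]
      transfer[OF bij_betw_paths[OF assms(1,2)]]
    by simp
qed

end
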